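(* Let $w\in\mathfrak{S}_n$ with a fixed reduced expression $w=s_1\cdots s_k$. If the map $\phi:\mathcal{C}^\downarrow\to[e,w]$, $\phi(C)=p(C)w$, is surjective, then $w$ avoids the patterns $4231$, $35142$, $42513$ and $351624$.
   Context: Permutations act on the right on $[n]$ and $uw$ means "first $u$, then $w$". $\mathfrak{S}_n$ is a Coxeter group with $S$ the adjacent transpositions and $T$ the set of all transpositions. $\mathfrak{S}_n$ acts on $V=\{x\in\mathbb{R}^n:\sum x_i=0\}$ by permuting coordinates; $(i\ j)$ is the reflection through $x_i=x_j$. Bruhat order: $u\le w$ iff some reduced expression of $w$ contains a subword expressing $u$; $[e,w]=\{u:u\le w\}$. Put $t_i=s_1\cdots s_{i-1}s_is_{i-1}\cdots s_1$, $H_i$ its reflecting hyperplane, $\mathcal{A}_w=\{H_1,\dots,H_k\}$ ordered $H_1>\cdots>H_k$. $L_w$: intersections of subsets of $\mathcal{A}_w$ ($\hat0=V$) ordered by reverse inclusion, covering $\lhd$; $\lambda(A\lhd B)=\min\{H\in\mathcal{A}_w:H\supseteq B,H\not\supseteq A\}$. $\mathcal{C}^\downarrow$: saturated chains $\hat0=X_0\lhd\cdots\lhd X_m$ with strictly decreasing labels $\lambda(X_{i-1}\lhd X_i)$. With $\lambda(X_{i-1}\lhd X_i)=H_{j_i}$, $p(C)=t_{j_1}\cdots t_{j_m}$. Pattern avoidance: for $p\in\mathfrak{S}_m$ in one-line notation, $w$ avoids $p$ if there are no $i_1<\cdots<i_m$ with $i_aw<i_bw\iff ap<bp$ for all $a,b$.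 *)

theory Defs
  imports Complex_Main "HOL-Combinatorics.Permutations" "HOL-Library.Sublist"
begin

text \<open>
  An element of \<open>S_n\<close> is a function \<open>w :: nat \<Rightarrow> nat\<close> with \<open>w permutes {1..n}\<close>, so that
  \<open>[w 1, \<dots>, w n]\<close> is its one-line notation. Permutations act on the right: \<open>u \<cdot> w\<close> is first \<open>u\<close>,
  then \<open>w\<close>, the opposite of the order of arguments of \<open>\<circ>\<close>.
\<close>

definition perm_mult :: "(nat \<Rightarrow> nat) \<Rightarrow> (nat \<Rightarrow> nat) \<Rightarrow> nat \<Rightarrow> nat" (infixl "\<cdot>" 70)
  where "u \<cdot> w = w \<circ> u"

definition word_prod :: "(nat \<Rightarrow> nat) list \<Rightarrow> nat \<Rightarrow> nat"
  where "word_prod ss = foldr (\<cdot>) ss id"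

definition simple_refls :: "nat \<Rightarrow> (nat \<Rightarrow> nat) set"
  where "simple_refls n = {transpose i (Suc i) | i. 1 \<le> i \<and> i < n}"

definition expresses :: "nat \<Rightarrow> (nat \<Rightarrow> nat) list \<Rightarrow> (nat \<Rightarrow> nat) \<Rightarrow> bool"
  where "expresses n ss w \<longleftrightarrow> set ss \<subseteq> simple_refls n \<and> word_prod ss = w"

definition reduced_expr :: "nat \<Rightarrow> (nat \<Rightarrow> nat) list \<Rightarrow> (nat \<Rightarrow> nat) \<Rightarrow> bool"
  where "reduced_expr n ss w \<longleftrightarrow>
    expresses n ss w \<and> (\<forall>ss'. expresses n ss' w \<longrightarrow> length ss \<le> length ss')"

definition bruhat_le :: "nat \<Rightarrow> (nat \<Rightarrow> nat) \<Rightarrow> (nat \<Rightarrow> nat) \<Rightarrow> bool"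
  where "bruhat_le n u w \<longleftrightarrow>
    (\<exists>ss us. reduced_expr n ss w \<and> subseq us ss \<and> expresses n us u)"

definition lower_interval :: "nat \<Rightarrow> (nat \<Rightarrow> nat) \<Rightarrow> (nat \<Rightarrow> nat) set"
  where "lower_interval n w = {u. u permutes {1..n} \<and> bruhat_le n u w}"

text \<open>
  A vector of \<open>\<real>^n\<close> is a function \<open>x :: nat \<Rightarrow> real\<close> vanishing outside \<open>{1..n}\<close>.
\<close>

definition V :: "nat \<Rightarrow> (nat \<Rightarrow> real) set"
  where "V n = {x. (\<forall>i. i \<notin> {1..n} \<longrightarrow> x i = 0) \<and> (\<Sum>i=1..n. x i) = 0}"

definition perm_act :: "(nat \<Rightarrow> nat) \<Rightarrow> (nat \<Rightarrow> real) \<Rightarrow> nat \<Rightarrow> real"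
  where "perm_act u x = (\<lambda>i. x (inv u i))"

text \<open>
  The reflecting hyperplane of a transposition is its fixed space in \<open>V n\<close>;
  for \<open>t = transpose i j\<close> this is \<open>x i = x j\<close>.
\<close>

definition fixed_space :: "nat \<Rightarrow> (nat \<Rightarrow> nat) \<Rightarrow> (nat \<Rightarrow> real) set"
  where "fixed_space n t = {x \<in> V n. perm_act t x = x}"

text \<open>
  In the following \<open>ss = [s_1, \<dots>, s_k]\<close> is the fixed reduced expression of \<open>w\<close>. The indices of
  \<open>t_i = s_1 \<cdots> s_{i-1} s_i s_{i-1} \<cdots> s_1\<close> and \<open>H_i\<close> run over \<open>1 \<le> i \<le> k\<close>.
\<close>

definition refl_t :: "(nat \<Rightarrow> nat) list \<Rightarrow> nat \<Rightarrow> nat \<Rightarrow> nat"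
  where "refl_t ss i = word_prod (take i ss @ rev (take (i - 1) ss))"

definition hyp :: "nat \<Rightarrow> (nat \<Rightarrow> nat) list \<Rightarrow> nat \<Rightarrow> (nat \<Rightarrow> real) set"
  where "hyp n ss i = fixed_space n (refl_t ss i)"

definition arrangement :: "nat \<Rightarrow> (nat \<Rightarrow> nat) list \<Rightarrow> (nat \<Rightarrow> real) set set"
  where "arrangement n ss = hyp n ss ` {1..length ss}"

text \<open>The order is \<open>H_1 > \<cdots> > H_k\<close>: a larger index means a smaller hyperplane.\<close>

definition hyp_less ::
    "nat \<Rightarrow> (nat \<Rightarrow> nat) list \<Rightarrow> (nat \<Rightarrow> real) set \<Rightarrow> (nat \<Rightarrow> real) set \<Rightarrow> bool"
  where "hyp_less n ss H H' \<longleftrightarrow>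
    (\<exists>i j. 1 \<le> j \<and> j < i \<and> i \<le> length ss \<and> H = hyp n ss i \<and> H' = hyp n ss j)"

definition int_lattice :: "nat \<Rightarrow> (nat \<Rightarrow> nat) list \<Rightarrow> (nat \<Rightarrow> real) set set"
  where "int_lattice n ss = {V n \<inter> \<Inter>\<B> | \<B>. \<B> \<subseteq> arrangement n ss}"

text \<open>The lattice is ordered by reverse inclusion, so \<open>B\<close> covers \<open>A\<close> requires \<open>B \<subset> A\<close>.\<close>

definition covered ::
    "nat \<Rightarrow> (nat \<Rightarrow> nat) list \<Rightarrow> (nat \<Rightarrow> real) set \<Rightarrow> (nat \<Rightarrow> real) set \<Rightarrow> bool"
  where "covered n ss A B \<longleftrightarrow>
    A \<in> int_lattice n ss \<and> B \<in> int_lattice n ss \<and> B \<subset> A \<and>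
    \<not> (\<exists>C \<in> int_lattice n ss. B \<subset> C \<and> C \<subset> A)"

definition edge_hyps ::
    "nat \<Rightarrow> (nat \<Rightarrow> nat) list \<Rightarrow> (nat \<Rightarrow> real) set \<Rightarrow> (nat \<Rightarrow> real) set \<Rightarrow> (nat \<Rightarrow> real) set set"
  where "edge_hyps n ss A B = {H \<in> arrangement n ss. B \<subseteq> H \<and> \<not> A \<subseteq> H}"

definition edge_label ::
    "nat \<Rightarrow> (nat \<Rightarrow> nat) list \<Rightarrow> (nat \<Rightarrow> real) set \<Rightarrow> (nat \<Rightarrow> real) set \<Rightarrow> (nat \<Rightarrow> real) set"
  where "edge_label n ss A B =
    (THE H. H \<in> edge_hyps n ss A B \<and> (\<forall>H' \<in> edge_hyps n ss A B. H' = H \<or> hyp_less n ss H H'))"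

text \<open>A chain \<open>X_0 \<lhd> \<cdots> \<lhd> X_m\<close> is the list \<open>[X_0, \<dots>, X_m]\<close>; it has \<open>m\<close> labels.\<close>

definition chain_labels ::
    "nat \<Rightarrow> (nat \<Rightarrow> nat) list \<Rightarrow> (nat \<Rightarrow> real) set list \<Rightarrow> (nat \<Rightarrow> real) set list"
  where "chain_labels n ss Xs =
    map (\<lambda>i. edge_label n ss (Xs ! i) (Xs ! Suc i)) [0..<length Xs - 1]"

definition saturated_chain :: "nat \<Rightarrow> (nat \<Rightarrow> nat) list \<Rightarrow> (nat \<Rightarrow> real) set list \<Rightarrow> bool"
  where "saturated_chain n ss Xs \<longleftrightarrow>
    Xs \<noteq> [] \<and> hd Xs = V n \<and>
    (\<forall>i. Suc i < length Xs \<longrightarrow> covered n ss (Xs ! i) (Xs ! Suc i))"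

definition decreasing_chains :: "nat \<Rightarrow> (nat \<Rightarrow> nat) list \<Rightarrow> (nat \<Rightarrow> real) set list set"
  where "decreasing_chains n ss =
    {Xs. saturated_chain n ss Xs \<and>
         sorted_wrt (\<lambda>H H'. hyp_less n ss H' H) (chain_labels n ss Xs)}"

definition hyp_index :: "nat \<Rightarrow> (nat \<Rightarrow> nat) list \<Rightarrow> (nat \<Rightarrow> real) set \<Rightarrow> nat"
  where "hyp_index n ss H = (THE j. 1 \<le> j \<and> j \<le> length ss \<and> hyp n ss j = H)"

definition chain_prod :: "nat \<Rightarrow> (nat \<Rightarrow> nat) list \<Rightarrow> (nat \<Rightarrow> real) set list \<Rightarrow> nat \<Rightarrow> nat"
  where "chain_prod n ss Xs =
    word_prod (map (\<lambda>H. refl_t ss (hyp_index n ss H)) (chain_labels n ss Xs))"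

definition phi ::
    "nat \<Rightarrow> (nat \<Rightarrow> nat) list \<Rightarrow> (nat \<Rightarrow> nat) \<Rightarrow> (nat \<Rightarrow> real) set list \<Rightarrow> nat \<Rightarrow> nat"
  where "phi n ss w Xs = chain_prod n ss Xs \<cdot> w"

text \<open>The pattern \<open>p\<close> is given by its one-line notation; positions in \<open>p\<close> and in the list \<open>is\<close> of
  indices \<open>i_1 < \<cdots> < i_m\<close> are counted from 0.\<close>

definition avoids :: "nat \<Rightarrow> (nat \<Rightarrow> nat) \<Rightarrow> nat list \<Rightarrow> bool"
  where "avoids n w p \<longleftrightarrow>
    \<not> (\<exists>is. length is = length p \<and> set is \<subseteq> {1..n} \<and> sorted_wrt (<) is \<and>
        (\<forall>a < length p. \<forall>b < length p. w (is ! a) < w (is ! b) \<longleftrightarrow> p ! a < p ! b))"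

end

theory Submission
  imports Defs
begin

text \<open>
  If \<open>C\<close> has labels \<open>H_{j_1}, \<dots>, H_{j_m}\<close>, then \<open>X_i = X_{i-1} \<inter> H_{j_i}\<close>, so the fixed space of
  \<open>p(C)\<close> is \<open>X_m\<close> and lies in every \<open>H_{j_i}\<close>. Hence the two points exchanged by \<open>t_{j_i}\<close> lie
  on one cycle of \<open>p(C)\<close>, and they form an inversion of \<open>w\<close>. Surjectivity of \<open>\<phi>\<close> therefore forces, for every
  \<open>u \<le> w\<close>, each cycle of \<open>u w^{-1}\<close> to be connected by inversions of \<open>w\<close>. Each of the four
  patterns produces some \<open>u \<le> w\<close> violating this, namely the one that rearranges the
  pattern \<open>4231\<close>, \<open>35142\<close>, \<open>42513\<close>, \<open>351624\<close> into \<open>1324\<close>, \<open>12435\<close>, \<open>13245\<close>, \<open>124356\<close>.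
\<close>

section \<open>Words in the simple reflections\<close>

lemma set_subseq_subset:
  assumes "subseq xs ys"
  shows "set xs \<subseteq> set ys"
  using list_emb_set[OF assms] by blast

lemma word_prod_Nil [simp]: "word_prod [] = id"
  by (simp add: word_prod_def)

lemma word_prod_Cons [simp]: "word_prod (s # ss) = word_prod ss \<circ> s"
  by (simp add: word_prod_def perm_mult_def)

lemma word_prod_append [simp]: "word_prod (us @ vs) = word_prod vs \<circ> word_prod us"
  by (induction us) (auto simp: comp_assoc)

lemma word_prod_permutes:
  assumes "set ss \<subseteq> simple_refls n"
  shows "word_prod ss permutes {1..n}"
  using assms
proof (induction ss)
  case Nil
  show "word_prod [] permutes {1..n}" by simp
next
  case (Cons s ss)
  then have "s permutes {1..n}"
    by (auto simp: simple_refls_def intro!: permutes_swap_id)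
  moreover have "word_prod ss permutes {1..n}"
    using Cons by simp
  ultimately show "word_prod (s # ss) permutes {1..n}"
    unfolding word_prod_Cons by (rule permutes_compose)
qed

lemma simple_refl_involution:
  assumes "s \<in> simple_refls n"
  shows "s \<circ> s = id"
  using assms by (auto simp: simple_refls_def)

lemma word_prod_rev:
  assumes "set ss \<subseteq> simple_refls n"
  shows "word_prod ss \<circ> word_prod (rev ss) = id"
  using assms
proof (induction ss)
  case (Cons s ss)
  have IH: "word_prod ss \<circ> word_prod (rev ss) = id"
    by (rule Cons.IH) (use Cons.prems in auto)
  have "word_prod (s # ss) \<circ> word_prod (rev (s # ss)) =
      word_prod ss \<circ> (s \<circ> s) \<circ> word_prod (rev ss)"
    by (simp add: comp_assoc)
  also have "\<dots> = id"
    using Cons.prems IH simple_refl_involution[of s n] by simp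
  finally show ?case .
qed simp

lemma word_prod_rev':
  assumes "set ss \<subseteq> simple_refls n"
  shows "word_prod (rev ss) \<circ> word_prod ss = id"
  using word_prod_rev[of "rev ss" n] assms by simp

text \<open>Follow \<open>a\<close> and \<open>b\<close> through the word: their images start in
  order and end reversed, so some letter exchanges them. Deleting that letter multiplies the product
  by \<open>transpose a b\<close>.\<close>

lemma strong_exchange:
  assumes "set ss \<subseteq> simple_refls n" and "a < b" and "word_prod ss b < word_prod ss a"
  shows "\<exists>us. subseq us ss \<and> length us < length ss \<and>
    word_prod us = word_prod ss \<circ> transpose a b"
  using assms
proof (induction ss arbitrary: a b)
  case (Cons s ss)
  from Cons.prems(1) obtain i where s: "s = transpose i (Suc i)"
    by (auto simp: simple_refls_def)
  show ?case
  proof (cases "a = i \<and> b = Suc i")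
    case True
    then have "word_prod (s # ss) \<circ> transpose a b = word_prod ss"
      by (simp add: s comp_assoc)
    moreover have "subseq ss (s # ss)" "length ss < length (s # ss)"
      by auto
    ultimately show ?thesis by metis
  next
    case False
    \<comment> \<open>An adjacent transposition reverses no pair other than its own.\<close>
    with Cons.prems(2) have "s a < s b"
      by (auto simp: s transpose_def)
    with Cons.prems have "\<exists>us. subseq us ss \<and> length us < length ss \<and>
        word_prod us = word_prod ss \<circ> transpose (s a) (s b)"
      by (intro Cons.IH) auto
    then obtain us where us: "subseq us ss" "length us < length ss"
        "word_prod us = word_prod ss \<circ> transpose (s a) (s b)"
      by blast
    have "transpose (s a) (s b) \<circ> s = s \<circ> transpose a b"
      by (auto simp: s transpose_def fun_eq_iff)
    with us have "word_prod (s # us) = word_prod (s # ss) \<circ> transpose a b"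
      by (simp add: comp_assoc)
    with us show ?thesis by (intro exI[of _ "s # us"]) auto
  qed
qed simp

section \<open>The reflections of a reduced expression\<close>

lemma refl_t_conjugate:
  assumes "i \<in> {1..length ss}"
  shows "refl_t ss i =
    word_prod (rev (take (i - 1) ss)) \<circ> ss ! (i - 1) \<circ> word_prod (take (i - 1) ss)"
proof -
  have "take i ss = take (i - 1) ss @ [ss ! (i - 1)]"
    using assms by (cases i) (simp_all add: take_Suc_conv_app_nth)
  then show ?thesis by (simp add: refl_t_def comp_assoc)
qed

lemma refl_t_transpose:
  assumes "set ss \<subseteq> simple_refls n" and "i \<in> {1..length ss}"
  shows "\<exists>a b. refl_t ss i = transpose a b \<and> a < b \<and> a \<in> {1..n} \<and> b \<in> {1..n}"
proof -
  define us where "us = take (i - 1) ss"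
  have us: "set us \<subseteq> simple_refls n"
    using assms(1) set_take_subset unfolding us_def by fast
  have "ss ! (i - 1) \<in> simple_refls n"
    using assms by (auto intro!: subsetD[OF assms(1)] nth_mem)
  then obtain j where j: "ss ! (i - 1) = transpose j (Suc j)" "1 \<le> j" "j < n"
    by (auto simp: simple_refls_def)
  define v where "v = word_prod (rev us)"
  have v: "v permutes {1..n}"
    unfolding v_def using us by (intro word_prod_permutes) simp
  have inv_v: "word_prod us \<circ> v = id" "v \<circ> word_prod us = id"
    unfolding v_def using word_prod_rev[OF us] word_prod_rev'[OF us] by auto
  have conj: "refl_t ss i = v \<circ> transpose j (Suc j) \<circ> word_prod us"
    unfolding v_def us_def by (simp only: refl_t_conjugate[OF assms(2)] j(1))
  \<comment> \<open>Conjugating a transposition by \<open>v\<close> relabels the two points it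
    exchanges.\<close>
  have comm: "v \<circ> transpose j (Suc j) = transpose (v j) (v (Suc j)) \<circ> v"
    using permutes_inj[OF v] by (auto simp: fun_eq_iff transpose_def dest: injD)
  have eq: "refl_t ss i = transpose (v j) (v (Suc j))"
    unfolding conj comm by (simp add: comp_assoc inv_v)
  have "v j \<in> {1..n}" "v (Suc j) \<in> {1..n}"
    using j by (simp_all only: permutes_in_image[OF v]) auto
  moreover have "v j \<noteq> v (Suc j)"
    using permutes_inj[OF v] by (auto dest: injD)
  ultimately show ?thesis
    using eq by (metis linorder_neqE_nat transpose_commute)
qed

text \<open>In \<open>t_i \<cdot> w\<close> the tail \<open>s_{i-1} \<cdots> s_1\<close> of
  \<open>t_i\<close> cancels the first \<open>i - 1\<close> letters of the word, and then the two
  copies of \<open>s_i\<close> cancel.\<close>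

lemma word_prod_delete:
  assumes "set ss \<subseteq> simple_refls n" and "i \<in> {1..length ss}"
  shows "word_prod ss \<circ> refl_t ss i = word_prod (take (i - 1) ss @ drop i ss)"
proof -
  define us s vs where "us = take (i - 1) ss" and "s = ss ! (i - 1)" and "vs = drop i ss"
  have ss: "ss = us @ s # vs"
    using assms(2) by (cases i) (simp_all add: us_def s_def vs_def Cons_nth_drop_Suc)
  have us: "set us \<subseteq> simple_refls n" and s: "s \<in> simple_refls n"
    using assms(1) by (auto simp: ss)
  have "word_prod ss \<circ> refl_t ss i =
      word_prod vs \<circ> (s \<circ> (word_prod us \<circ> word_prod (rev us)) \<circ> s) \<circ> word_prod us"
    unfolding refl_t_conjugate[OF assms(2)] us_def[symmetric] s_def[symmetric]
    by (simp add: ss comp_assoc)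
  also have "\<dots> = word_prod (us @ vs)"
    by (simp add: word_prod_rev[OF us] simple_refl_involution[OF s])
  finally show ?thesis by (simp add: us_def vs_def)
qed

text \<open>Deleting letter \<open>i\<close> leaves a word for
  \<open>w \<circ> transpose a b\<close>. If \<open>a\<close>, \<open>b\<close> were not an
  inversion of \<open>w\<close>, they would be one of that product, and strong exchange would lead
  back to \<open>w\<close> with at least two letters fewer.\<close>

lemma refl_t_inversion:
  assumes "reduced_expr n ss w" and "i \<in> {1..length ss}"
  shows "\<exists>a b. refl_t ss i = transpose a b \<and> a < b \<and> a \<in> {1..n} \<and> b \<in> {1..n} \<and> w b < w a"
proof -
  have ss: "set ss \<subseteq> simple_refls n" and w: "word_prod ss = w"
    and min: "\<And>ss'. expresses n ss' w \<Longrightarrow> length ss \<le> length ss'"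
    using assms(1) by (auto simp: reduced_expr_def expresses_def)
  obtain a b where ab: "refl_t ss i = transpose a b" "a < b" "a \<in> {1..n}" "b \<in> {1..n}"
    using refl_t_transpose[OF ss assms(2)] by blast
  define us where "us = take (i - 1) ss @ drop i ss"
  have us: "set us \<subseteq> simple_refls n"
    using ss by (auto simp: us_def dest: in_set_takeD in_set_dropD)
  have len: "length us < length ss"
    using assms(2) by (auto simp: us_def)
  have prod: "word_prod us = w \<circ> transpose a b"
    using word_prod_delete[OF ss assms(2)] ab(1) w by (simp add: us_def)
  have "\<not> w a < w b"
  proof
    assume "w a < w b"
    then obtain vs where vs: "subseq vs us" "length vs < length us"
        "word_prod vs = word_prod us \<circ> transpose a b"
      using strong_exchange[OF us ab(2)] by (auto simp: prod)
    have "word_prod vs = w"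
      using vs(3) by (simp add: prod comp_assoc)
    with vs(1) us have "expresses n vs w"
      by (auto simp: expresses_def dest: set_subseq_subset)
    with min vs(2) len show False by fastforce
  qed
  moreover have "w a \<noteq> w b"
    using permutes_inj[OF word_prod_permutes[OF ss]] ab(2) w by (auto dest: injD)
  ultimately show ?thesis
    using ab by (intro exI[of _ a] exI[of _ b]) auto
qed

text \<open>If \<open>t_i = t_j\<close>, deleting both letters multiplies \<open>w\<close> by the
  square of a transposition, which gives an expression of \<open>w\<close> shorter by two.\<close>

lemma refl_t_distinct:
  assumes "reduced_expr n ss w" and "1 \<le> i" and "i < j" and "j \<le> length ss"
  shows "refl_t ss i \<noteq> refl_t ss j"
proof
  assume eq: "refl_t ss i = refl_t ss j"
  have ss: "set ss \<subseteq> simple_refls n" and w: "word_prod ss = w"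
    and min: "\<And>ss'. expresses n ss' w \<Longrightarrow> length ss \<le> length ss'"
    using assms(1) by (auto simp: reduced_expr_def expresses_def)
  define us where "us = take (j - 1) ss @ drop j ss"
  have us: "set us \<subseteq> simple_refls n"
    using ss by (auto simp: us_def dest: in_set_takeD in_set_dropD)
  have len: "length us = length ss - 1" "i \<le> length us"
    using assms by (auto simp: us_def)
  have prod: "word_prod us = w \<circ> refl_t ss j"
    using word_prod_delete[OF ss, of j] assms w by (simp add: us_def)
  define vs where "vs = take (i - 1) us @ drop i us"
  \<comment> \<open>The deleted position \<open>j\<close> lies beyond the first \<open>i\<close>
    letters, so \<open>t_i\<close> is the same for the shortened word.\<close>
  have "i \<le> j - 1" using assms by simp
  then have "refl_t us i = refl_t ss i"
    using assms by (simp add: refl_t_def us_def min_absorb1)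
  then have "word_prod vs = w \<circ> (refl_t ss j \<circ> refl_t ss j)"
    using word_prod_delete[OF us, of i] assms len prod eq by (simp add: vs_def comp_assoc)
  also obtain a b where "refl_t ss j = transpose a b"
    using refl_t_transpose[OF ss, of j] assms by auto
  then have "refl_t ss j \<circ> refl_t ss j = id" by simp
  finally have "expresses n vs w"
    using us by (auto simp: expresses_def vs_def dest: in_set_takeD in_set_dropD)
  moreover have "length vs < length ss"
    using assms len by (auto simp: vs_def)
  ultimately show False using min by fastforce
qed

section \<open>Fixed spaces\<close>

lemma fixed_space_iff:
  assumes "p permutes {1..n}"
  shows "x \<in> fixed_space n p \<longleftrightarrow> x \<in> V n \<and> x \<circ> p = x"
proof -
  have "x \<circ> inv p = x \<longleftrightarrow> x \<circ> p = x"
    using permutes_inv_o[OF assms] by (metis comp_assoc comp_id)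
  then show ?thesis by (simp add: fixed_space_def perm_act_def comp_def)
qed

lemma comp_transpose_eq_iff: "x \<circ> transpose a b = x \<longleftrightarrow> x a = x b"
  by (auto simp: fun_eq_iff transpose_def)

lemma fixed_space_transpose:
  assumes "a \<in> {1..n}" and "b \<in> {1..n}"
  shows "x \<in> fixed_space n (transpose a b) \<longleftrightarrow> x \<in> V n \<and> x a = x b"
  using assms by (simp add: fixed_space_iff permutes_swap_id comp_transpose_eq_iff)

text \<open>Projection onto \<open>V n\<close> by subtracting the mean. It turns any test function
  into a vector of \<open>V n\<close> without changing which coordinates in \<open>{1..n}\<close>
  agree.\<close>

definition center :: "nat \<Rightarrow> (nat \<Rightarrow> real) \<Rightarrow> nat \<Rightarrow> real"
  where "center n f = (\<lambda>i. if i \<in> {1..n} then f i - (\<Sum>j=1..n. f j) / real n else 0)"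

lemma center_in_V: "center n f \<in> V n"
proof (cases "n = 0")
  case False
  have "(\<Sum>i=1..n. center n f i) = (\<Sum>i=1..n. f i - (\<Sum>j=1..n. f j) / real n)"
    by (intro sum.cong) (auto simp: center_def)
  also have "\<dots> = 0"
    using False by (simp add: sum_subtractf)
  finally show ?thesis by (auto simp: V_def center_def)
qed (auto simp: V_def center_def)

lemma center_eq_iff:
  assumes "a \<in> {1..n}" and "b \<in> {1..n}"
  shows "center n f a = center n f b \<longleftrightarrow> f a = f b"
  using assms by (simp add: center_def)

lemma center_comp:
  assumes "p permutes {1..n}" and "f \<circ> p = f"
  shows "center n f \<circ> p = center n f"
  using assms permutes_in_image[OF assms(1)] by (auto simp: center_def fun_eq_iff)

lemma fixed_space_transpose_inject:
  assumes "a \<in> {1..n}" "b \<in> {1..n}" "c \<in> {1..n}" "d \<in> {1..n}" "c \<noteq> d"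
    and eq: "fixed_space n (transpose a b) = fixed_space n (transpose c d)"
  shows "transpose a b = transpose c d"
proof -
  have *: "f a = f b \<longleftrightarrow> f c = f d" for f :: "nat \<Rightarrow> real"
    using eq fixed_space_transpose[of _ n] center_in_V[of n f] center_eq_iff[of _ n _ f] assms(1-4)
    by metis
  \<comment> \<open>The indicator of \<open>c\<close> separates \<open>c\<close> from
    \<open>d\<close>, hence \<open>a\<close> from \<open>b\<close>, which puts \<open>c\<close> in
    \<open>{a, b}\<close>; likewise for \<open>d\<close>.\<close>
  have "c \<in> {a, b}" "d \<in> {a, b}"
    using *[of "\<lambda>i. if i = c then 1 else 0"] *[of "\<lambda>i. if i = d then 1 else 0"] assms(5)
    by (auto split: if_splits)
  with assms(5) show ?thesis by (auto simp: transpose_commute)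
qed

text \<open>
  For \<open>y\<close> fixed by \<open>p\<close> and \<open>x\<close> fixed by \<open>t \<circ> p\<close> the pairings of \<open>y\<close> with \<open>x\<close> and with \<open>x \<circ> t\<close>
  agree; their difference is \<open>(y a - y b) (x b - x a)\<close>.
\<close>

lemma fixed_space_mult_transpose:
  assumes p: "p permutes {1..n}" and ab: "a \<in> {1..n}" "b \<in> {1..n}"
    and nsub: "\<not> fixed_space n p \<subseteq> fixed_space n (transpose a b)"
  shows "fixed_space n (transpose a b \<circ> p) = fixed_space n p \<inter> fixed_space n (transpose a b)"
proof -
  let ?t = "transpose a b"
  have t: "?t permutes {1..n}" using ab by (rule permutes_swap_id)
  have tp: "?t \<circ> p permutes {1..n}" using p t by (rule permutes_compose)
  from nsub obtain y where y: "y \<in> V n" "y \<circ> p = y" "y a \<noteq> y b"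
    using fixed_space_transpose[OF ab] fixed_space_iff[OF p] by blast
  have "x a = x b" if x: "x \<circ> (?t \<circ> p) = x" for x :: "nat \<Rightarrow> real"
  proof -
    have "(\<Sum>i=1..n. y i * x (?t i)) = (\<Sum>i=1..n. y (p i) * x (?t (p i)))"
      using sum.permute[OF p, of "\<lambda>i. y i * x (?t i)"] by (simp add: comp_def)
    also have "\<dots> = (\<Sum>i=1..n. y i * x i)"
      using x y(2) by (simp add: fun_eq_iff)
    finally have "(\<Sum>i=1..n. y i * (x (?t i) - x i)) = 0"
      by (simp add: right_diff_distrib sum_subtractf)
    moreover have "(\<Sum>i=1..n. y i * (x (?t i) - x i)) = (\<Sum>i\<in>{a, b}. y i * (x (?t i) - x i))"
      using ab by (intro sum.mono_neutral_right) (auto simp: transpose_def)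
    moreover have "a \<noteq> b" using y by auto
    ultimately have "(y a - y b) * (x b - x a) = 0"
      by (simp add: algebra_simps)
    with y(3) show ?thesis by simp
  qed
  moreover have "x \<circ> (?t \<circ> p) = x \<longleftrightarrow> x \<circ> p = x" if "x a = x b" for x :: "nat \<Rightarrow> real"
    using that comp_transpose_eq_iff[of x a b] by (simp flip: comp_assoc)
  ultimately show ?thesis
    using fixed_space_iff[OF tp] fixed_space_iff[OF p] fixed_space_transpose[OF ab] by blast
qed

section \<open>Chains in the intersection lattice\<close>

text \<open>A hyperplane determines its transposition, and the \<open>t_i\<close> are distinct. This
  makes the index of a hyperplane well defined and \<open>hyp_less\<close> a strict order.\<close>

lemma hyp_inj:
  assumes "reduced_expr n ss w"
  shows "inj_on (hyp n ss) {1..length ss}"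
proof (rule linorder_inj_onI)
  fix i j assume ij: "i < j" "i \<in> {1..length ss}" "j \<in> {1..length ss}"
  obtain a b where "refl_t ss i = transpose a b" "a \<in> {1..n}" "b \<in> {1..n}"
    using refl_t_inversion[OF assms ij(2)] by blast
  moreover obtain c d where "refl_t ss j = transpose c d" "c < d" "c \<in> {1..n}" "d \<in> {1..n}"
    using refl_t_inversion[OF assms ij(3)] by blast
  ultimately show "hyp n ss i \<noteq> hyp n ss j"
    using refl_t_distinct[OF assms, of i j] ij fixed_space_transpose_inject[of a n b c d]
    by (auto simp: hyp_def)
qed auto

lemma hyp_index_hyp:
  assumes "reduced_expr n ss w" and "i \<in> {1..length ss}"
  shows "hyp_index n ss (hyp n ss i) = i"
  unfolding hyp_index_def using assms inj_onD[OF hyp_inj[OF assms(1)]]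
  by (intro the_equality) auto

lemma hyp_less_asym:
  assumes "reduced_expr n ss w" and "hyp_less n ss H H'"
  shows "\<not> hyp_less n ss H' H"
proof
  assume "hyp_less n ss H' H"
  with assms(2) obtain i j i' j' where *: "1 \<le> j" "j < i" "i \<le> length ss"
      "H = hyp n ss i" "H' = hyp n ss j"
      "1 \<le> j'" "j' < i'" "i' \<le> length ss" "H' = hyp n ss i'" "H = hyp n ss j'"
    unfolding hyp_less_def by blast
  then have "i = j'" "j = i'"
    using inj_onD[OF hyp_inj[OF assms(1)], of i j'] inj_onD[OF hyp_inj[OF assms(1)], of j i']
    by auto
  with * show False by simp
qed

text \<open>Since \<open>edge_label\<close> is a definite description, a unique minimum has to be
  exhibited before anything can be said about it.\<close>

lemma edge_label_in_edge_hyps: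
  assumes red: "reduced_expr n ss w" and cov: "covered n ss A B"
  shows "edge_label n ss A B \<in> edge_hyps n ss A B"
proof -
  let ?E = "edge_hyps n ss A B"
  let ?P = "\<lambda>H. H \<in> ?E \<and> (\<forall>H' \<in> ?E. H' = H \<or> hyp_less n ss H H')"
  define J where "J = {i \<in> {1..length ss}. hyp n ss i \<in> ?E}"
  obtain \<B> where B: "B = V n \<inter> \<Inter>\<B>" "\<B> \<subseteq> arrangement n ss"
    using cov by (auto simp: covered_def int_lattice_def)
  have "A \<subseteq> V n" "\<not> A \<subseteq> B"
    using cov by (auto simp: covered_def int_lattice_def)
  \<comment> \<open>If \<open>A\<close> lay in every member of \<open>\<B>\<close>, it would lie in
    \<open>B\<close>.\<close>
  with B obtain H where H: "H \<in> \<B>" "\<not> A \<subseteq> H" by blast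
  with B have "H \<in> ?E" by (auto simp: edge_hyps_def)
  then have J: "J \<noteq> {}" "finite J"
    by (auto simp: J_def edge_hyps_def arrangement_def)
  \<comment> \<open>The largest index gives the minimum, because
    \<open>H_1 > \<dots> > H_k\<close>.\<close>
  define m where "m = Max J"
  have m: "m \<in> J" "\<And>i. i \<in> J \<Longrightarrow> i \<le> m"
    using J by (auto simp: m_def)
  have P: "?P (hyp n ss m)"
  proof (intro conjI ballI)
    show "hyp n ss m \<in> ?E" using m(1) by (simp add: J_def)
    fix H' assume H': "H' \<in> ?E"
    then have "H' \<in> arrangement n ss" by (simp add: edge_hyps_def)
    then obtain i where i: "i \<in> {1..length ss}" "H' = hyp n ss i"
      by (auto simp: arrangement_def)
    with H' have "i \<in> J" by (simp add: J_def)
    then have "i \<le> m" by (rule m(2))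
    show "H' = hyp n ss m \<or> hyp_less n ss (hyp n ss m) H'"
    proof (cases "i = m")
      case False
      with \<open>i \<le> m\<close> have "1 \<le> i \<and> i < m \<and> m \<le> length ss"
        using i(1) m(1) by (simp add: J_def)
      with i(2) show ?thesis unfolding hyp_less_def by blast
    qed (simp add: i(2))
  qed
  have "?P (edge_label n ss A B)"
    unfolding edge_label_def
    by (rule theI[of ?P, OF P]) (use P hyp_less_asym[OF red] in blast)
  then show ?thesis by blast
qed

text \<open>\<open>A \<inter> H\<close> lies in the lattice, contains \<open>B\<close> and is
  strictly smaller than \<open>A\<close>, and the covering leaves no room between \<open>A\<close>
  and \<open>B\<close>.\<close>

lemma covered_eq_Int:
  assumes "covered n ss A B" and "H \<in> edge_hyps n ss A B"
  shows "B = A \<inter> H"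
proof -
  obtain \<A> where A: "A = V n \<inter> \<Inter>\<A>" "\<A> \<subseteq> arrangement n ss"
    using assms(1) by (auto simp: covered_def int_lattice_def)
  have "A \<inter> H = V n \<inter> \<Inter>(insert H \<A>)" using A by auto
  moreover have "insert H \<A> \<subseteq> arrangement n ss"
    using A assms(2) by (auto simp: edge_hyps_def)
  ultimately have "A \<inter> H \<in> int_lattice n ss"
    unfolding int_lattice_def by blast
  moreover have "B \<subseteq> A \<inter> H" "A \<inter> H \<subset> A"
    using assms by (auto simp: covered_def edge_hyps_def)
  ultimately show ?thesis
    using assms(1) by (auto simp: covered_def)
qed

text \<open>By induction the fixed spaces of the partial products are the elements of the chain:
  each step intersects with a hyperplane not containing the previous space, as
  \<open>fixed_space_mult_transpose\<close> requires. The last space lies in all hyperplanes met on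
  the way.\<close>

lemma chain_prod_factors:
  assumes red: "reduced_expr n ss w" and chain: "saturated_chain n ss Xs"
  shows "\<exists>ts. chain_prod n ss Xs = word_prod ts \<and> set ts \<subseteq> refl_t ss ` {1..length ss} \<and>
    (\<forall>t \<in> set ts. fixed_space n (word_prod ts) \<subseteq> fixed_space n t)"
proof -
  define ts where "ts = map (\<lambda>H. refl_t ss (hyp_index n ss H)) (chain_labels n ss Xs)"
  have len: "length ts = length Xs - 1"
    by (simp add: ts_def chain_labels_def)
  have step: "ts ! i \<in> refl_t ss ` {1..length ss} \<and> Xs ! Suc i = Xs ! i \<inter> fixed_space n (ts ! i)
      \<and> \<not> Xs ! i \<subseteq> fixed_space n (ts ! i)" if i: "i < length ts" for i
  proof -
    let ?H = "edge_label n ss (Xs ! i) (Xs ! Suc i)"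
    have cov: "covered n ss (Xs ! i) (Xs ! Suc i)"
      using chain i len by (auto simp: saturated_chain_def)
    have H: "?H \<in> edge_hyps n ss (Xs ! i) (Xs ! Suc i)"
      by (rule edge_label_in_edge_hyps[OF red cov])
    then have "?H \<in> arrangement n ss" by (simp add: edge_hyps_def)
    then obtain j where j: "j \<in> {1..length ss}" "?H = hyp n ss j"
      by (auto simp: arrangement_def)
    have "ts ! i = refl_t ss j"
      using i j hyp_index_hyp[OF red j(1)] by (simp add: ts_def chain_labels_def)
    moreover from this have "fixed_space n (ts ! i) = ?H"
      by (simp add: j(2) hyp_def)
    ultimately show ?thesis
      using covered_eq_Int[OF cov H] H j(1) by (auto simp: edge_hyps_def)
  qed
  have "word_prod (take m ts) permutes {1..n} \<and> Xs ! m = fixed_space n (word_prod (take m ts)) \<and>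
      (\<forall>i<m. Xs ! m \<subseteq> fixed_space n (ts ! i))" if "m \<le> length ts" for m
    using that
  proof (induction m)
    case 0
    have "Xs ! 0 = V n"
      using chain by (auto simp: saturated_chain_def hd_conv_nth)
    then show ?case
      using fixed_space_iff[OF permutes_id, of _ n] by (auto simp: permutes_id simp del: id_apply)
  next
    case (Suc m)
    let ?p = "word_prod (take m ts)"
    from Suc have m: "m < length ts" and IH: "?p permutes {1..n}" "Xs ! m = fixed_space n ?p"
      "\<forall>i<m. Xs ! m \<subseteq> fixed_space n (ts ! i)"
      by auto
    obtain a b where ab: "ts ! m = transpose a b" "a \<in> {1..n}" "b \<in> {1..n}"
      using step[OF m] refl_t_inversion[OF red] by (metis imageE)
    \<comment> \<open>The last factor of the right action is the outermost one under
      \<open>\<circ>\<close>.\<close>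
    have prod: "word_prod (take (Suc m) ts) = transpose a b \<circ> ?p"
      using m ab by (simp add: take_Suc_conv_app_nth)
    have "Xs ! Suc m = fixed_space n (transpose a b \<circ> ?p)"
      using step[OF m] fixed_space_mult_transpose[OF IH(1) ab(2,3)] by (simp add: IH(2) ab(1))
    moreover have "transpose a b \<circ> ?p permutes {1..n}"
      using IH(1) ab by (intro permutes_compose permutes_swap_id)
    moreover have "\<forall>i<Suc m. Xs ! Suc m \<subseteq> fixed_space n (ts ! i)"
      using step[OF m] IH(3) by (auto simp: less_Suc_eq)
    ultimately show ?case unfolding prod by blast
  qed
  from this[of "length ts"] have "\<forall>t \<in> set ts. fixed_space n (word_prod ts) \<subseteq> fixed_space n t"
    by (metis in_set_conv_nth order_refl take_all)
  moreover have "set ts \<subseteq> refl_t ss ` {1..length ss}"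
    using step by (metis in_set_conv_nth subsetI)
  ultimately show ?thesis
    by (intro exI[of _ ts]) (simp add: chain_prod_def ts_def)
qed

lemma comp_word_prod:
  assumes "\<And>t. t \<in> set ts \<Longrightarrow> f \<circ> t = f"
  shows "f \<circ> word_prod ts = f"
  using assms by (induction ts) (simp_all flip: comp_assoc)

text \<open>\<open>J\<close> is a union of cycles of the product, and no inversion of
  \<open>w\<close> links \<open>I\<close> to the rest of \<open>J\<close>. The centred indicator of
  \<open>J\<close> is fixed by the product, hence by each factor \<open>transpose a b\<close>, so
  \<open>J\<close> contains both \<open>a\<close> and \<open>b\<close> or neither. As they form an
  inversion of \<open>w\<close>, the same holds for \<open>I\<close>, and every factor preserves
  \<open>I\<close>.\<close>

lemma chain_prod_preserves:
  assumes red: "reduced_expr n ss w" and chain: "saturated_chain n ss Xs"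
    and J: "\<And>i. chain_prod n ss Xs i \<in> J \<longleftrightarrow> i \<in> J" and "I \<subseteq> J"
    and IJ: "\<And>a b. \<lbrakk>a \<in> J; b \<in> J; a < b; w b < w a\<rbrakk> \<Longrightarrow> a \<in> I \<longleftrightarrow> b \<in> I"
  shows "chain_prod n ss Xs i \<in> I \<longleftrightarrow> i \<in> I"
proof -
  let ?p = "chain_prod n ss Xs"
  obtain ts where ts: "?p = word_prod ts" "set ts \<subseteq> refl_t ss ` {1..length ss}"
    "\<And>t. t \<in> set ts \<Longrightarrow> fixed_space n ?p \<subseteq> fixed_space n t"
    using chain_prod_factors[OF red chain] by metis
  have trans: "\<exists>a b. t = transpose a b \<and> a < b \<and> a \<in> {1..n} \<and> b \<in> {1..n} \<and> w b < w a"
    if "t \<in> set ts" for t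
    using that ts(2) refl_t_inversion[OF red] by blast
  have "word_prod us permutes {1..n}" if "set us \<subseteq> set ts" for us
    using that
  proof (induction us)
    case (Cons t us)
    then obtain a b where "t = transpose a b" "a \<in> {1..n}" "b \<in> {1..n}"
      using trans[of t] by auto
    moreover have "word_prod us permutes {1..n}"
      using Cons by simp
    ultimately show "word_prod (t # us) permutes {1..n}"
      unfolding word_prod_Cons by (blast intro: permutes_compose permutes_swap_id)
  next
    case Nil
    show "word_prod [] permutes {1..n}" by simp
  qed
  then have p: "?p permutes {1..n}" using ts(1) by simp
  define g :: "nat \<Rightarrow> real" where "g = (\<lambda>i. if i \<in> J then 1 else 0)"
  have "g \<circ> ?p = g" using J by (auto simp: g_def)
  then have g: "center n g \<in> fixed_space n ?p"
    using center_comp[OF p] center_in_V fixed_space_iff[OF p] by blast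
  define f :: "nat \<Rightarrow> bool" where "f = (\<lambda>i. i \<in> I)"
  have "f \<circ> t = f" if t: "t \<in> set ts" for t
  proof -
    obtain a b where ab: "t = transpose a b" "a < b" "a \<in> {1..n}" "b \<in> {1..n}" "w b < w a"
      using trans[OF t] by blast
    have "center n g a = center n g b"
      using g ts(3)[OF t] fixed_space_transpose[OF ab(3,4)] ab(1) by blast
    then have "a \<in> J \<longleftrightarrow> b \<in> J"
      using center_eq_iff[OF ab(3,4)] by (auto simp: g_def split: if_splits)
    then have "a \<in> I \<longleftrightarrow> b \<in> I"
      using IJ[OF _ _ ab(2,5)] \<open>I \<subseteq> J\<close> by blast
    then show ?thesis by (auto simp: f_def ab(1) fun_eq_iff transpose_def)
  qed
  then have "f \<circ> ?p = f" unfolding ts(1) by (rule comp_word_prod)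
  then show ?thesis by (auto simp: f_def fun_eq_iff)
qed

section \<open>The obstruction\<close>

text \<open>With this order of composition, \<open>w \<circ> swaps ps\<close> arises from the
  one-line notation of \<open>w\<close> by exchanging the entries at the listed positions, from the
  head of the list on.\<close>

definition swaps :: "(nat \<times> nat) list \<Rightarrow> nat \<Rightarrow> nat"
  where "swaps ps = foldr (\<lambda>(a, b) p. transpose a b \<circ> p) ps id"

lemma swaps_simps [simp]:
  "swaps [] i = i"
  "swaps ((a, b) # ps) i = transpose a b (swaps ps i)"
  by (simp_all add: swaps_def)

lemma inj_swaps: "inj (swaps ps)"
  by (induction ps) (auto simp: inj_def dest!: transpose_eq_imp_eq)

text \<open>A descending path in the Bruhat graph: every exchange undoes an inversion of the current
  map.\<close>

fun inversion_path :: "(nat \<Rightarrow> nat) \<Rightarrow> (nat \<times> nat) list \<Rightarrow> bool"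
  where
    "inversion_path u [] \<longleftrightarrow> True"
  | "inversion_path u ((a, b) # ps) \<longleftrightarrow>
      a < b \<and> u b < u a \<and> inversion_path (u \<circ> transpose a b) ps"

text \<open>One strong exchange per pair; subwords of subwords are subwords. This certifies that
  \<open>w \<circ> swaps ps\<close> lies below \<open>w\<close>.\<close>

lemma inversion_path_subword:
  assumes "set ss \<subseteq> simple_refls n" and "inversion_path (word_prod ss) ps"
  shows "\<exists>us. subseq us ss \<and> word_prod us = word_prod ss \<circ> swaps ps"
  using assms
proof (induction ps arbitrary: ss)
  case Nil
  have "swaps [] = id" by (simp add: fun_eq_iff)
  then show ?case by (intro exI[of _ ss]) simp
next
  case (Cons ab ps)
  obtain a b where ab: "ab = (a, b)" by (cases ab)
  with Cons.prems obtain us where us: "subseq us ss"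
      "word_prod us = word_prod ss \<circ> transpose a b"
    using strong_exchange[of ss n a b] by auto
  have "set us \<subseteq> simple_refls n"
    using us(1) Cons.prems(1) by (auto dest: set_subseq_subset)
  moreover have "inversion_path (word_prod us) ps"
    using Cons.prems(2) by (simp add: ab us(2))
  ultimately obtain vs where "subseq vs us" "word_prod vs = word_prod us \<circ> swaps ps"
    using Cons.IH by blast
  moreover have "swaps (ab # ps) = transpose a b \<circ> swaps ps"
    by (simp add: ab fun_eq_iff)
  ultimately have "subseq vs ss \<and> word_prod vs = word_prod ss \<circ> swaps (ab # ps)"
    using us by (simp add: comp_assoc subseq_order.trans[of vs us ss])
  then show ?case by blast
qed

text \<open>Here \<open>w \<circ> swaps ps\<close> lies in the lower interval, so it is some
  \<open>\<phi>(C)\<close>. Cancelling \<open>w\<close> forces \<open>p(C)\<close> to be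
  \<open>swaps ps\<close>, which must then preserve \<open>I\<close>.\<close>

lemma surjective_obstruction:
  assumes w: "w permutes {1..n}" and red: "reduced_expr n ss w"
    and surj: "\<forall>u \<in> lower_interval n w. \<exists>C \<in> decreasing_chains n ss. phi n ss w C = u"
    and path: "inversion_path w ps"
    and J: "finite J" "swaps ps ` J \<subseteq> J" and "I \<subseteq> J"
    and IJ: "\<And>a b. \<lbrakk>a \<in> J; b \<in> J; a < b; w b < w a\<rbrakk> \<Longrightarrow> a \<in> I \<longleftrightarrow> b \<in> I"
    and "i \<in> I"
  shows "swaps ps i \<in> I"
proof -
  let ?p = "swaps ps"
  have ss: "set ss \<subseteq> simple_refls n" "word_prod ss = w"
    using red by (auto simp: reduced_expr_def expresses_def)
  obtain us where us: "subseq us ss" "word_prod us = w \<circ> ?p"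
    using inversion_path_subword[OF ss(1)] path by (auto simp: ss(2))
  have set_us: "set us \<subseteq> simple_refls n"
    using us(1) ss(1) by (auto dest: set_subseq_subset)
  have "bruhat_le n (w \<circ> ?p) w"
    using red us set_us by (auto simp: bruhat_le_def expresses_def)
  moreover have "w \<circ> ?p permutes {1..n}"
    using word_prod_permutes[OF set_us] us(2) by simp
  ultimately obtain C where C: "C \<in> decreasing_chains n ss" "phi n ss w C = w \<circ> ?p"
    using surj by (auto simp: lower_interval_def)
  have eq: "chain_prod n ss C = ?p"
    using C(2) permutes_inj[OF w] by (auto simp: phi_def perm_mult_def fun_eq_iff dest: injD)
  \<comment> \<open>An injection of the finite set \<open>J\<close> into itself is onto, which turns
    the assumed inclusion into the equivalence needed for \<open>J\<close>.\<close>
  have "?p ` J = J"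
    using J inj_swaps by (intro endo_inj_surj) (auto intro: inj_on_subset)
  then have "?p i \<in> J \<longleftrightarrow> i \<in> J" for i
    using inj_swaps inj_image_mem_iff by metis
  moreover have "saturated_chain n ss C"
    using C(1) by (simp add: decreasing_chains_def)
  ultimately have "?p i \<in> I \<longleftrightarrow> i \<in> I"
    using chain_prod_preserves[OF red _ _ \<open>I \<subseteq> J\<close> IJ] unfolding eq[symmetric] by blast
  with \<open>i \<in> I\<close> show ?thesis by simp
qed

section \<open>The four patterns\<close>

theorem theorem4p1:
  fixes n :: nat and w :: "nat \<Rightarrow> nat" and ss :: "(nat \<Rightarrow> nat) list"
  assumes "w permutes {1..n}"
    and "reduced_expr n ss w"
    and "\<forall>u \<in> lower_interval n w. \<exists>C \<in> decreasing_chains n ss. phi n ss w C = u"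
  shows "avoids n w [4,2,3,1] \<and> avoids n w [3,5,1,4,2] \<and>
         avoids n w [4,2,5,1,3] \<and> avoids n w [3,5,1,6,2,4]"
proof -
  note obstruction = surjective_obstruction[OF assms]
  have "avoids n w [4,2,3,1]"
    unfolding avoids_def
  proof (rule notI, elim exE conjE)
    fix xs :: "nat list"
    assume len: "length xs = length [4,2,3,1::nat]" and sorted: "sorted_wrt (<) xs"
      and pat: "\<forall>a < length [4,2,3,1::nat]. \<forall>b < length [4,2,3,1::nat].
        w (xs ! a) < w (xs ! b) \<longleftrightarrow> [4,2,3,1::nat] ! a < [4,2,3,1] ! b"
    obtain a b c d where xs: "xs = [a, b, c, d]"
      using len by (auto simp: length_Suc_conv)
    have ord: "a < b" "b < c" "c < d" using sorted by (auto simp: xs)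
    have vals: "w d < w b" "w b < w c" "w c < w a"
      using pat[rule_format, of 3 1] pat[rule_format, of 1 2] pat[rule_format, of 2 0]
      by (simp_all add: xs)
    \<comment> \<open>The exchanges lead from \<open>4231\<close> to \<open>1324\<close>. Their
      product swaps \<open>b\<close> and \<open>c\<close>, whose values \<open>2\<close>,
      \<open>3\<close> form no inversion.\<close>
    have "swaps [(a, b), (a, d), (b, c), (c, d)] b \<in> {b}"
      by (rule obstruction[where J = "{b, c}"])
        (use ord vals in \<open>auto simp: transpose_def\<close>)
    then show False using ord by (auto simp: transpose_def)
  qed
  moreover have "avoids n w [3,5,1,4,2]"
    unfolding avoids_def
  proof (rule notI, elim exE conjE)
    fix xs :: "nat list"
    assume len: "length xs = length [3,5,1,4,2::nat]" and sorted: "sorted_wrt (<) xs"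
      and pat: "\<forall>a < length [3,5,1,4,2::nat]. \<forall>b < length [3,5,1,4,2::nat].
        w (xs ! a) < w (xs ! b) \<longleftrightarrow> [3,5,1,4,2::nat] ! a < [3,5,1,4,2] ! b"
    obtain a b c d e where xs: "xs = [a, b, c, d, e]"
      using len by (auto simp: length_Suc_conv)
    have ord: "a < b" "b < c" "c < d" "d < e" using sorted by (auto simp: xs)
    have vals: "w c < w e" "w e < w a" "w a < w d" "w d < w b"
      using pat[rule_format, of 2 4] pat[rule_format, of 4 0] pat[rule_format, of 0 3]
        pat[rule_format, of 3 1]
      by (simp_all add: xs)
    \<comment> \<open>The product has the cycle \<open>a\<close>, \<open>c\<close>, \<open>d\<close>
      with values \<open>3\<close>, \<open>1\<close>, \<open>4\<close>; here \<open>d\<close> is in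
      no inversion, yet it is sent to \<open>a\<close>.\<close>
    have "swaps [(a, c), (b, c), (b, e), (c, d), (d, e)] d \<in> {d}"
      by (rule obstruction[where J = "{a, c, d}"])
        (use ord vals in \<open>auto simp: transpose_def\<close>)
    then show False using ord by (auto simp: transpose_def)
  qed
  moreover have "avoids n w [4,2,5,1,3]"
    unfolding avoids_def
  proof (rule notI, elim exE conjE)
    fix xs :: "nat list"
    assume len: "length xs = length [4,2,5,1,3::nat]" and sorted: "sorted_wrt (<) xs"
      and pat: "\<forall>a < length [4,2,5,1,3::nat]. \<forall>b < length [4,2,5,1,3::nat].
        w (xs ! a) < w (xs ! b) \<longleftrightarrow> [4,2,5,1,3::nat] ! a < [4,2,5,1,3] ! b"
    obtain a b c d e where xs: "xs = [a, b, c, d, e]"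
      using len by (auto simp: length_Suc_conv)
    have ord: "a < b" "b < c" "c < d" "d < e" using sorted by (auto simp: xs)
    have vals: "w d < w b" "w b < w e" "w e < w a" "w a < w c"
      using pat[rule_format, of 3 1] pat[rule_format, of 1 4] pat[rule_format, of 4 0]
        pat[rule_format, of 0 2]
      by (simp_all add: xs)
    \<comment> \<open>The product has the cycle \<open>b\<close>, \<open>e\<close>,
      \<open>c\<close>. At \<open>b\<close>, \<open>c\<close>, \<open>e\<close> the values are
      \<open>2\<close>, \<open>5\<close>, \<open>3\<close>, so \<open>b\<close> is in no inversion,
      yet it is sent to \<open>e\<close>.\<close>
    have "swaps [(a, b), (a, d), (b, e), (c, d), (d, e)] b \<in> {b}"
      by (rule obstruction[where J = "{b, c, e}"])
        (use ord vals in \<open>auto simp: transpose_def\<close>)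
    then show False using ord by (auto simp: transpose_def)
  qed
  moreover have "avoids n w [3,5,1,6,2,4]"
    unfolding avoids_def
  proof (rule notI, elim exE conjE)
    fix xs :: "nat list"
    assume len: "length xs = length [3,5,1,6,2,4::nat]" and sorted: "sorted_wrt (<) xs"
      and pat: "\<forall>a < length [3,5,1,6,2,4::nat]. \<forall>b < length [3,5,1,6,2,4::nat].
        w (xs ! a) < w (xs ! b) \<longleftrightarrow> [3,5,1,6,2,4::nat] ! a < [3,5,1,6,2,4] ! b"
    obtain a b c d e f where xs: "xs = [a, b, c, d, e, f]"
      using len by (auto simp: length_Suc_conv)
    have ord: "a < b" "b < c" "c < d" "d < e" "e < f" using sorted by (auto simp: xs)
    have vals: "w c < w e" "w e < w a" "w a < w f" "w f < w b" "w b < w d"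
      using pat[rule_format, of 2 4] pat[rule_format, of 4 0] pat[rule_format, of 0 5]
        pat[rule_format, of 5 1] pat[rule_format, of 1 3]
      by (simp_all add: xs)
    \<comment> \<open>The product has the cycle \<open>a\<close>, \<open>c\<close>,
      \<open>f\<close>, \<open>d\<close>. The values \<open>3\<close>, \<open>1\<close>,
      \<open>6\<close>, \<open>4\<close> at \<open>a\<close>, \<open>c\<close>, \<open>d\<close>,
      \<open>f\<close> are inverted only within \<open>{a, c}\<close> and within
      \<open>{d, f}\<close>, yet \<open>c\<close> is sent to \<open>f\<close>.\<close>
    have "swaps [(a, c), (b, c), (b, e), (c, f), (d, e), (e, f)] i \<in> {a, c}" if "i \<in> {a, c}" for i
      by (rule obstruction[where J = "{a, c, d, f}"])
        (use ord vals that in \<open>auto simp: transpose_def\<close>)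
    from this[of a] this[of c] show False using ord by (auto simp: transpose_def)
  qed
  ultimately show ?thesis by blast
qed

end
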